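(* Let $\Gamma$ be an interior reduced, connected labeled oriented graph (LOG) with $m$ vertices. Then its complexity satisfies $$\operatorname{cp}(\Gamma) \le \frac{m+1}{2}.$$
   Context: A labeled oriented graph (LOG) $\Gamma$ is a finite, nonempty, oriented graph with vertex set $V(\Gamma)$ and edge set $E(\Gamma)$, together with a labeling function $l: E(\Gamma)\to V(\Gamma)$. The underlying undirected graph is assumed to be simple: no vertex is adjacent to itself, and any two vertices are joined by at most one edge. "Connected" refers to the underlying undirected graph. The LOG is interior reduced if for every edge $e$ with endpoints $x,y$ one has $l(e)\notin\{x,y\}$. For $S\subseteq V(\Gamma)$, the set $T_S\subseteq V(\Gamma)$ of vertices reachable from $S$ is the smallest set such that (1) $S\subseteq T_S$, and (2) if $e$ is an edge with endpoints $x$ and $y$ (in either orientation) and both $y\in T_S$ and $l(e)\in T_S$, then $x\in T_S$. One says that $\Gamma$ is reachable from $S$ if $T_S=V(\Gamma)$. The complexity $\operatorname{cp}(\Gamma)$ is the minimum of $|S|$ over all $S\subseteq V(\Gamma)$ such that $\Gamma$ is reachable from $S$. *)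

theory Defs
  imports Complex_Main "Graph_Theory.Digraph_Component"
begin

text \<open>
  The locale \<^locale>\<open>nomulti_digraph\<close> excludes only parallel arcs of equal direction; simplicity of
  the underlying undirected graph also excludes a pair of opposite arcs, whence
  \<open>no_multi_edges\<close>.
\<close>

locale labeled_oriented_graph = fin_digraph G + loopfree_digraph G
  for G :: "('v, 'e) pre_digraph" (structure) +
  fixes l :: "'e \<Rightarrow> 'v"
  assumes verts_nonempty: "verts G \<noteq> {}"
    and no_multi_edges: "\<lbrakk>e \<in> arcs G; f \<in> arcs G;
      {tail G e, head G e} = {tail G f, head G f}\<rbrakk> \<Longrightarrow> e = f"
    and label_in_verts: "e \<in> arcs G \<Longrightarrow> l e \<in> verts G"

definition interior_reduced :: "('v, 'e) pre_digraph \<Rightarrow> ('e \<Rightarrow> 'v) \<Rightarrow> bool" where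
  "interior_reduced G l \<longleftrightarrow> (\<forall>e \<in> arcs G. l e \<notin> {tail G e, head G e})"

inductive_set reachable_set ::
    "('v, 'e) pre_digraph \<Rightarrow> ('e \<Rightarrow> 'v) \<Rightarrow> 'v set \<Rightarrow> 'v set"
  for G :: "('v, 'e) pre_digraph" and l :: "'e \<Rightarrow> 'v" and S :: "'v set" where
  base: "x \<in> S \<Longrightarrow> x \<in> reachable_set G l S"
| to_tail: "\<lbrakk>e \<in> arcs G; head G e \<in> reachable_set G l S; l e \<in> reachable_set G l S\<rbrakk>
    \<Longrightarrow> tail G e \<in> reachable_set G l S"
| to_head: "\<lbrakk>e \<in> arcs G; tail G e \<in> reachable_set G l S; l e \<in> reachable_set G l S\<rbrakk>
    \<Longrightarrow> head G e \<in> reachable_set G l S"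

definition reachable_from :: "('v, 'e) pre_digraph \<Rightarrow> ('e \<Rightarrow> 'v) \<Rightarrow> 'v set \<Rightarrow> bool" where
  "reachable_from G l S \<longleftrightarrow> reachable_set G l S = verts G"

definition complexity :: "('v, 'e) pre_digraph \<Rightarrow> ('e \<Rightarrow> 'v) \<Rightarrow> nat" where
  "complexity G l = Min (card ` {S. S \<subseteq> verts G \<and> reachable_from G l S})"

context labeled_oriented_graph
begin

lemma reachable_set_subset_verts:
  assumes "S \<subseteq> verts G"
  shows "reachable_set G l S \<subseteq> verts G"
proof
  fix x assume "x \<in> reachable_set G l S"
  then show "x \<in> verts G"
    using assms by induction auto
qed

lemma reachable_from_verts: "reachable_from G l (verts G)"
  unfolding reachable_from_def
  using reachable_set_subset_verts[of "verts G"] by (auto intro: reachable_set.base)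

text \<open>The minimum defining \<^const>\<open>complexity\<close> is taken over a finite nonempty set.\<close>

lemma complexity_attained:
  "\<exists>S \<subseteq> verts G. reachable_from G l S \<and> card S = complexity G l"
proof -
  let ?A = "{S. S \<subseteq> verts G \<and> reachable_from G l S}"
  have "finite ?A" by simp
  moreover have "?A \<noteq> {}" using reachable_from_verts by blast
  ultimately have "Min (card ` ?A) \<in> card ` ?A" by (intro Min_in) auto
  then show ?thesis unfolding complexity_def by auto
qed

end

end

theory Submission
  imports Defs
begin

text \<open>
  If \<open>T\<close> is the set reached from \<open>S\<close> and \<open>T\<close> is not everything, connectedness gives an edge \<open>e\<close> from
  \<open>T\<close> to some \<open>y\<close> outside \<open>T\<close>. As \<open>T\<close> is closed, \<open>l e\<close> lies outside \<open>T\<close>, and \<open>l e\<close> differs from \<open>y\<close>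
  since the graph is interior reduced. Adding \<open>l e\<close> to \<open>S\<close> therefore enlarges the reached set by
  at least the two vertices \<open>l e\<close> and \<open>y\<close>. Starting from a single vertex, this keeps
  \<open>2 * card S \<le> card T + 1\<close>.
\<close>

lemma reachable_set_mono:
  assumes "S \<subseteq> S'"
  shows "reachable_set G l S \<subseteq> reachable_set G l S'"
proof
  fix x assume "x \<in> reachable_set G l S"
  then show "x \<in> reachable_set G l S'"
    using assms by induction (auto intro: reachable_set.intros)
qed

text \<open>A path in the symmetric closure \<open>mk_symmetric G\<close> joins a vertex of
  \<open>T\<close> to one outside, and the step at which it first leaves \<open>T\<close> comes from
  an arc of \<open>G\<close>, possibly reversed.\<close>

lemma (in wf_digraph) connected_crossing_arc:
  assumes "Digraph_Component.connected G" and "T \<subseteq> verts G" and "T \<noteq> {}" and "T \<noteq> verts G"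
  obtains e where "e \<in> arcs G" and "tail G e \<in> T \<longleftrightarrow> head G e \<notin> T"
proof -
  interpret S: pair_wf_digraph "mk_symmetric G" ..
  obtain a b where a: "a \<in> T" and b: "b \<in> verts G" "b \<notin> T"
    using assms by blast
  have "a \<rightarrow>\<^sup>*\<^bsub>mk_symmetric G\<^esub> b"
    using assms(1,2) a b
    unfolding connected_def strongly_connected_def by auto
  then have "\<exists>e \<in> arcs G. tail G e \<in> T \<longleftrightarrow> head G e \<notin> T"
    using a b(2)
  proof (induction rule: S.converse_reachable_induct)
    case base
    then show ?case by simp
  next
    case (step x y)
    show ?case
    proof (cases "y \<in> T")
      case False
      then show ?thesis
        using step.hyps(1) step.prems(1) by (auto simp: parcs_mk_symmetric)
    qed (use step in blast)
  qed
  then show thesis using that by blast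
qed

context labeled_oriented_graph
begin

lemma complexity_le_card:
  assumes "S \<subseteq> verts G" and "reachable_from G l S"
  shows "complexity G l \<le> card S"
  unfolding complexity_def using assms by (intro Min_le) auto

lemma interior_reduced_extend:
  assumes "interior_reduced G l" and "Digraph_Component.connected G"
    and S: "S \<subseteq> verts G" "S \<noteq> {}" and "\<not> reachable_from G l S"
  obtains z where "z \<in> verts G" and "z \<notin> S"
    and "card (reachable_set G l S) + 2 \<le> card (reachable_set G l (insert z S))"
proof -
  let ?T = "reachable_set G l S"
  have ST: "S \<subseteq> ?T" by (simp add: subset_iff reachable_set.base)
  then have T: "?T \<subseteq> verts G" "?T \<noteq> {}" "?T \<noteq> verts G"
    using S(2) assms(5) reachable_set_subset_verts[OF S(1)]
    by (simp_all add: reachable_from_def) blast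
  obtain e where e: "e \<in> arcs G" "tail G e \<in> ?T \<longleftrightarrow> head G e \<notin> ?T"
    using connected_crossing_arc[OF assms(2) T] .
  let ?U = "reachable_set G l (insert (l e) S)"
  \<comment> \<open>With \<open>l e\<close> in \<open>?T\<close>, closure would carry membership
    across \<open>e\<close> from its one endpoint in \<open>?T\<close> to the other.\<close>
  have leT: "l e \<notin> ?T"
    using e(2) reachable_set.to_tail[OF e(1), of l S] reachable_set.to_head[OF e(1), of l S]
    by argo
  have le: "l e \<noteq> tail G e" "l e \<noteq> head G e"
    using e(1) assms(1) by (simp_all add: interior_reduced_def)
  have TU: "?T \<subseteq> ?U" by (rule reachable_set_mono) auto
  have leU: "l e \<in> ?U" by (simp add: reachable_set.base)
  \<comment> \<open>\<open>y\<close> is the endpoint of \<open>e\<close> missing from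
    \<open>?T\<close>; once \<open>l e\<close> is added, it is reached across
    \<open>e\<close>.\<close>
  obtain y where y: "y \<notin> ?T" "y \<in> ?U" "y \<noteq> l e"
  proof (cases "tail G e \<in> ?T")
    case True
    then have "head G e \<in> ?U"
      using TU by (intro reachable_set.to_head[OF e(1) _ leU]) blast
    then show thesis using True e(2) le(2) that[of "head G e"] by simp
  next
    case False
    then have "tail G e \<in> ?U"
      using e(2) TU by (intro reachable_set.to_tail[OF e(1) _ leU]) blast
    then show thesis using False le(1) that[of "tail G e"] by simp
  qed
  have U: "finite ?U" and finT: "finite ?T"
    using reachable_set_subset_verts[of "insert (l e) S"] T(1) S(1) label_in_verts[OF e(1)]
    by (auto intro: finite_subset)
  have "card ?T + 2 = card (insert (l e) (insert y ?T))"
    using finT y leT by simp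
  also have "\<dots> \<le> card ?U"
    using U TU leU y by (intro card_mono) auto
  finally show thesis
    using that[of "l e"] label_in_verts[OF e(1)] leT ST by blast
qed

lemma double_complexity_le:
  assumes "interior_reduced G l" and "Digraph_Component.connected G"
  shows "2 * complexity G l \<le> card (verts G) + 1"
proof -
  have "2 * complexity G l \<le> card (verts G) + 1"
    if "S \<subseteq> verts G" "S \<noteq> {}" "2 * card S \<le> card (reachable_set G l S) + 1" for S
    using that
  \<comment> \<open>Each new \<open>z\<close> lies outside \<open>S\<close>, so the measure drops;
    the invariant survives because \<open>card S\<close> grows by 1 and the reached set by at least
    2.\<close>
  proof (induction "card (verts G - S)" arbitrary: S rule: less_induct)
    case less
    show ?case
    proof (cases "reachable_from G l S")
      case True
      then show ?thesis
        using complexity_le_card[of S] less.prems by (simp add: reachable_from_def)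
    next
      case False
      then obtain z where z: "z \<in> verts G" "z \<notin> S"
        "card (reachable_set G l S) + 2 \<le> card (reachable_set G l (insert z S))"
        using interior_reduced_extend assms less.prems by metis
      have "finite S" using less.prems(1) by (rule finite_subset) simp
      moreover have "card (verts G - insert z S) < card (verts G - S)"
        using z by (intro psubset_card_mono) auto
      ultimately show ?thesis
        using less.hyps[of "insert z S"] less.prems z by simp
    qed
  qed
  note bound = this
  obtain v where v: "v \<in> verts G" using verts_nonempty by blast
  \<comment> \<open>For \<open>{v}\<close> the invariant reads 2 \<le>
    \<open>card (reachable_set G l {v}) + 1\<close>, which amounts to the reached set being
    nonempty.\<close>
  moreover have "card (reachable_set G l {v}) > 0"
    using v reachable_set_subset_verts[of "{v}"] finite_verts
    by (auto simp: card_gt_0_iff intro: finite_subset reachable_set.base)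
  ultimately show ?thesis by (intro bound[of "{v}"]) auto
qed

end

theorem theorem1p1:
  fixes G :: "('v, 'e) pre_digraph" and l :: "'e \<Rightarrow> 'v" and m :: nat
  assumes "labeled_oriented_graph G l"
    and "interior_reduced G l"
    and "Digraph_Component.connected G"
    and "card (verts G) = m"
  shows "real (complexity G l) \<le> (real m + 1) / 2"
  using labeled_oriented_graph.double_complexity_le[OF assms(1-3)] assms(4) by simp

end
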